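(* Suppose that $c:\mathbb{X}\times\mathbb{U}\to\mathbb{R}$ is non-negative, measurable, and bounded. Then the optimal cost $J(P,\cdot)$ is sequentially upper semi-continuous on the set of channels $\mathcal{Q}$ under setwise convergence: if $\{Q_n\}$ is a sequence in $\mathcal{Q}$ converging setwise at input $P$ to $Q\in\mathcal{Q}$, then $\limsup_{n\to\infty}J(P,Q_n)\le J(P,Q)$.
   Context: $\mathbb{X}\subset\mathbb{R}^n$, $\mathbb{Y}\subset\mathbb{R}^m$ and $\mathbb{U}\subset\mathbb{R}^k$ are Borel sets ($\mathbb{U}$ nonempty). A channel $Q$ is a stochastic kernel from $\mathbb{X}$ to $\mathbb{Y}$: $Q(\cdot|x)$ is a Borel probability measure on $\mathbb{Y}$ for every $x\in\mathbb{X}$, and $x\mapsto Q(A|x)$ is Borel measurable for every Borel $A\subset\mathbb{Y}$. $\mathcal{Q}$ is the set of all channels from $\mathbb{X}$ to $\mathbb{Y}$. $P$ is a fixed Borel probability measure on $\mathbb{X}$, and $PQ$ is the joint probability measure on $\mathbb{X}\times\mathbb{Y}$ given by $PQ(A)=\int_A Q(dy|x)P(dx)$. The single-stage optimal cost is $$J(P,Q)=\inf_{\gamma\in\mathcal{G}}\int_{\mathbb{X}\times\mathbb{Y}} c(x,\gamma(y))\,Q(dy|x)P(dx),$$ where $\mathcal{G}$ is the set of all Borel measurable functions $\gamma:\mathbb{Y}\to\mathbb{U}$. $Q_n\to Q$ setwise at input $P$ means that $PQ_n(A)\to PQ(A)$ for every Borel set $A\subset\mathbb{X}\times\mathbb{Y}$.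 *)

theory Defs
  imports "HOL-Probability.Probability"
begin

abbreviation borel_on :: "'a::topological_space set \<Rightarrow> 'a measure" where
  "borel_on S \<equiv> restrict_space borel S"

text \<open>A channel is a function on the whole ambient type; only its values on \<open>X\<close> matter.\<close>

definition channels ::
  "'x::topological_space set \<Rightarrow> 'y::topological_space set \<Rightarrow> ('x \<Rightarrow> 'y measure) set" where
  "channels X Y = {Q.
     (\<forall>x\<in>X. prob_space (Q x) \<and> sets (Q x) = sets (borel_on Y)) \<and>
     (\<forall>A\<in>sets (borel_on Y). (\<lambda>x. measure (Q x) A) \<in> borel_measurable (borel_on X))}"

text \<open>\<open>joint X Y P Q\<close> is the measure \<open>PQ(A) = \<integral>\<^sub>A Q(dy|x)P(dx)\<close> on the Borel subsets of
  \<open>X \<times> Y\<close>; see \<open>emeasure_joint\<close> below.\<close>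

definition joint ::
  "'x::topological_space set \<Rightarrow> 'y::topological_space set \<Rightarrow> 'x measure \<Rightarrow> ('x \<Rightarrow> 'y measure)
     \<Rightarrow> ('x \<times> 'y) measure" where
  "joint X Y P Q = P \<bind> (\<lambda>x. distr (Q x) (borel_on (X \<times> Y)) (Pair x))"

text \<open>The infimum is taken in the extended reals, so it needs no side conditions. A policy is
  likewise a function on the whole ambient type, of which only the values on \<open>Y\<close> matter.\<close>

definition opt_cost ::
  "'x::topological_space set \<Rightarrow> 'y::topological_space set \<Rightarrow> 'u::topological_space set
     \<Rightarrow> ('x \<times> 'u \<Rightarrow> real) \<Rightarrow> 'x measure \<Rightarrow> ('x \<Rightarrow> 'y measure) \<Rightarrow> ereal" where
  "opt_cost X Y U c P Q =
     (INF \<gamma> \<in> borel_on Y \<rightarrow>\<^sub>M borel_on U. ereal (\<integral>(x, y). c (x, \<gamma> y) \<partial>joint X Y P Q))"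

definition setwise_at ::
  "'x::topological_space set \<Rightarrow> 'y::topological_space set \<Rightarrow> 'x measure
     \<Rightarrow> (nat \<Rightarrow> 'x \<Rightarrow> 'y measure) \<Rightarrow> ('x \<Rightarrow> 'y measure) \<Rightarrow> bool" where
  "setwise_at X Y P Qs Q \<longleftrightarrow>
     (\<forall>A\<in>sets (borel_on (X \<times> Y)).
        (\<lambda>n. measure (joint X Y P (Qs n)) A) \<longlonglongrightarrow> measure (joint X Y P Q) A)"

lemma channels_eq_kernels: "channels X Y = borel_on X \<rightarrow>\<^sub>M prob_algebra (borel_on Y)"
proof (intro set_eqI iffI)
  fix Q assume Q: "Q \<in> channels X Y"
  show "Q \<in> borel_on X \<rightarrow>\<^sub>M prob_algebra (borel_on Y)"
    unfolding prob_algebra_def measurable_restrict_space2_iff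
  proof (intro conjI measurable_subprob_algebra)
    fix x assume "x \<in> space (borel_on X)"
    then have "x \<in> X" by (simp add: space_restrict_space)
    with Q show "subprob_space (Q x)" "sets (Q x) = sets (borel_on Y)"
      by (auto simp: channels_def prob_space_imp_subprob_space)
  next
    fix A assume A: "A \<in> sets (borel_on Y)"
    have "(\<lambda>x. ennreal (measure (Q x) A)) \<in> borel_measurable (borel_on X)"
      using Q A by (auto simp: channels_def)
    moreover have "emeasure (Q x) A = ennreal (measure (Q x) A)" if "x \<in> space (borel_on X)" for x
    proof -
      interpret prob_space "Q x" using Q that by (auto simp: channels_def space_restrict_space)
      show ?thesis by (rule emeasure_eq_measure)
    qed
    ultimately show "(\<lambda>x. emeasure (Q x) A) \<in> borel_measurable (borel_on X)"
      by (simp cong: measurable_cong)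
  next
    show "Q \<in> space (borel_on X) \<rightarrow> Collect prob_space"
      using Q by (auto simp: channels_def space_restrict_space)
  qed
next
  fix Q assume Q: "Q \<in> borel_on X \<rightarrow>\<^sub>M prob_algebra (borel_on Y)"
  have "prob_space (Q x) \<and> sets (Q x) = sets (borel_on Y)" if "x \<in> X" for x
    using measurable_space[OF Q, of x] that by (simp add: space_prob_algebra space_restrict_space)
  then show "Q \<in> channels X Y"
    unfolding channels_def
    using measurable_compose[OF measurable_prob_algebraD[OF Q] measurable_measure_subprob_algebra]
    by blast
qed

lemma joint_kernel:
  fixes X :: "'x::second_countable_topology set" and Y :: "'y::second_countable_topology set"
  assumes "Q \<in> channels X Y"
  shows "(\<lambda>x. distr (Q x) (borel_on (X \<times> Y)) (Pair x)) \<in> borel_on X \<rightarrow>\<^sub>M prob_algebra (borel_on (X \<times> Y))"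
proof (rule measurable_distr_prob_space2)
  show "Q \<in> borel_on X \<rightarrow>\<^sub>M prob_algebra (borel_on Y)"
    using assms by (simp add: channels_eq_kernels)
  have "(\<lambda>(x, y). (x, y)) \<in> borel_on X \<Otimes>\<^sub>M borel_on Y \<rightarrow>\<^sub>M borel \<Otimes>\<^sub>M borel"
    unfolding split_beta
    by (intro measurable_Pair measurable_compose[OF measurable_fst] measurable_compose[OF measurable_snd]
        measurable_restrict_space1) auto
  then show "(\<lambda>(x, y). (x, y)) \<in> borel_on X \<Otimes>\<^sub>M borel_on Y \<rightarrow>\<^sub>M borel_on (X \<times> Y)"
    unfolding borel_prod
    by (intro measurable_restrict_space2) (auto simp: space_pair_measure space_restrict_space)
qed

lemma emeasure_joint:
  fixes X :: "'x::second_countable_topology set" and Y :: "'y::second_countable_topology set"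
  assumes P: "prob_space P" "sets P = sets (borel_on X)" and Q: "Q \<in> channels X Y"
    and A: "A \<in> sets (borel_on (X \<times> Y))"
  shows "emeasure (joint X Y P Q) A = (\<integral>\<^sup>+x. emeasure (Q x) {y. (x, y) \<in> A} \<partial>P)"
proof -
  have "emeasure (joint X Y P Q) A =
      (\<integral>\<^sup>+x. emeasure (distr (Q x) (borel_on (X \<times> Y)) (Pair x)) A \<partial>P)"
    unfolding joint_def using P A joint_kernel[OF Q]
    by (intro emeasure_bind_prob_algebra) (auto simp: space_prob_algebra)
  also have "\<dots> = (\<integral>\<^sup>+x. emeasure (Q x) {y. (x, y) \<in> A} \<partial>P)"
  proof (rule nn_integral_cong)
    fix x assume "x \<in> space P"
    then have x: "x \<in> X"
      using sets_eq_imp_space_eq[OF P(2)] by (simp add: space_restrict_space)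
    then have Qx: "sets (Q x) = sets (borel_on Y)" using Q by (simp add: channels_def)
    have "Pair x \<in> borel_on Y \<rightarrow>\<^sub>M borel"
      unfolding borel_prod[symmetric]
      by (intro measurable_restrict_space1 measurable_Pair) auto
    then have "Pair x \<in> borel_on Y \<rightarrow>\<^sub>M borel_on (X \<times> Y)"
      using x by (intro measurable_restrict_space2) (auto simp: space_restrict_space)
    then have "Pair x \<in> Q x \<rightarrow>\<^sub>M borel_on (X \<times> Y)"
      using Qx by (simp cong: measurable_cong_sets)
    moreover have "Pair x -` A \<inter> space (Q x) = {y. (x, y) \<in> A}"
      using sets.sets_into_space[OF A] sets_eq_imp_space_eq[OF Qx]
      by (auto simp: space_restrict_space)
    ultimately show "emeasure (distr (Q x) (borel_on (X \<times> Y)) (Pair x)) A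
        = emeasure (Q x) {y. (x, y) \<in> A}"
      using A by (simp add: emeasure_distr)
  qed
  finally show ?thesis .
qed

end

theory Submission
  imports Defs
begin

text \<open>
  Fix a policy \<open>\<gamma>\<close>. Its cost under a channel \<open>R\<close> is the integral of the bounded measurable
  function \<open>(x, y) \<mapsto> c (x, \<gamma> y)\<close> against \<open>joint X Y P R\<close>, and this function does not involve \<open>R\<close>.
  Setwise convergence of the joint measures is convergence of the integrals of indicators; since
  bounded measurable functions are uniform limits of simple functions, it extends to the integrals
  of all bounded measurable functions (\<open>integral_tendsto_of_setwise\<close>). Hence the cost of each fixed
  policy is continuous along the sequence, and the optimal cost, being an infimum of continuous
  functions of the channel, is upper semi-continuous. Lower semi-continuity does not follow
  from this argument, because the near-optimal policy may change with the channel.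
\<close>

text \<open>Rounding down to the grid \<open>\<epsilon> \<int>\<close> moves every value of \<open>f\<close> by at most \<open>\<epsilon>\<close>, and leaves only
  finitely many values because \<open>f\<close> is bounded.\<close>

lemma bounded_uniform_step_approx:
  fixes f :: "'a \<Rightarrow> real"
  assumes f: "f \<in> borel_measurable M" and B: "\<And>x. x \<in> space M \<Longrightarrow> \<bar>f x\<bar> \<le> B" and e: "0 < \<epsilon>"
  obtains I :: "int set" and S :: "int \<Rightarrow> 'a set" and a :: "int \<Rightarrow> real"
  where "finite I" "\<And>k. S k \<in> sets M"
    "\<And>x. x \<in> space M \<Longrightarrow> \<bar>f x - (\<Sum>k\<in>I. a k * indicator (S k) x)\<bar> \<le> \<epsilon>"
proof -
  define S where "S k = {x \<in> space M. \<lfloor>f x / \<epsilon>\<rfloor> = k}" for k :: int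
  define I where "I = {\<lfloor>- B / \<epsilon>\<rfloor>..\<lfloor>B / \<epsilon>\<rfloor>}"
  have "S k \<in> sets M" for k
    unfolding S_def using f by measurable
  moreover have "\<bar>f x - (\<Sum>k\<in>I. (of_int k * \<epsilon>) * indicator (S k) x)\<bar> \<le> \<epsilon>" if x: "x \<in> space M" for x
  proof -
    let ?k = "\<lfloor>f x / \<epsilon>\<rfloor>"
    have "- B \<le> f x" "f x \<le> B"
      using B[OF x] by linarith+
    then have "- B / \<epsilon> \<le> f x / \<epsilon>" "f x / \<epsilon> \<le> B / \<epsilon>"
      using e by (intro divide_right_mono; simp)+
    then have "?k \<in> I"
      unfolding I_def by (auto intro: floor_mono)
    moreover have "(\<Sum>k\<in>I. (of_int k * \<epsilon>) * indicator (S k) x)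
        = (\<Sum>k\<in>I. if k = ?k then of_int k * \<epsilon> else 0)"
      using x by (intro sum.cong) (auto simp: S_def)
    ultimately have sum: "(\<Sum>k\<in>I. (of_int k * \<epsilon>) * indicator (S k) x) = of_int ?k * \<epsilon>"
      by (simp add: I_def)
    have "of_int ?k \<le> f x / \<epsilon>" "f x / \<epsilon> \<le> of_int ?k + 1"
      by linarith+
    then have "of_int ?k * \<epsilon> \<le> f x" "f x \<le> of_int ?k * \<epsilon> + \<epsilon>"
      using e by (simp_all only: pos_le_divide_eq pos_divide_le_eq distrib_right mult_1)
    with e show ?thesis
      unfolding sum by linarith
  qed
  ultimately show ?thesis
    using that[of I S "\<lambda>k. of_int k * \<epsilon>"] by (auto simp: I_def)
qed

lemma abs_integral_diff_le:
  fixes f g :: "'a \<Rightarrow> real"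
  assumes "finite_measure M" "integrable M f" "integrable M g"
    and "\<And>x. x \<in> space M \<Longrightarrow> \<bar>f x - g x\<bar> \<le> \<epsilon>"
  shows "\<bar>(\<integral>x. f x \<partial>M) - (\<integral>x. g x \<partial>M)\<bar> \<le> \<epsilon> * measure M (space M)"
proof -
  interpret finite_measure M by fact
  have "\<bar>(\<integral>x. f x \<partial>M) - (\<integral>x. g x \<partial>M)\<bar> = \<bar>\<integral>x. f x - g x \<partial>M\<bar>"
    using assms by simp
  also have "\<dots> \<le> (\<integral>x. \<bar>f x - g x\<bar> \<partial>M)"
    by (rule integral_abs_bound)
  also have "\<dots> \<le> (\<integral>x. \<epsilon> \<partial>M)"
    using assms by (intro integral_mono) auto
  finally show ?thesis by (simp add: mult.commute)
qed

text \<open>For step functions the claim is linearity. The uniform error of a step approximation changes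
  the integrals by at most the error times the total masses; these converge, being the masses of
  the whole space, so the error is uniform along the sequence.\<close>

lemma integral_tendsto_of_setwise:
  fixes f :: "'a \<Rightarrow> real"
  assumes fin: "\<And>n. finite_measure (Ms n)" "finite_measure M"
    and sets: "\<And>n. sets (Ms n) = sets M"
    and conv: "\<And>A. A \<in> sets M \<Longrightarrow> (\<lambda>n. measure (Ms n) A) \<longlonglongrightarrow> measure M A"
    and f: "f \<in> borel_measurable M" and B: "\<And>x. x \<in> space M \<Longrightarrow> \<bar>f x\<bar> \<le> B"
  shows "(\<lambda>n. \<integral>x. f x \<partial>Ms n) \<longlonglongrightarrow> (\<integral>x. f x \<partial>M)"
proof (rule LIMSEQ_I)
  fix r :: real assume r: "0 < r"
  have sp: "space (Ms n) = space M" for n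
    using sets by (rule sets_eq_imp_space_eq)
  have f_int: "integrable N f" if "finite_measure N" "sets N = sets M" for N
    using that B f sets_eq_imp_space_eq[OF that(2)]
    by (intro finite_measure.integrable_const_bound[where B = B])
      (auto cong: measurable_cong_sets intro!: AE_I2)
  \<comment> \<open>This one mass bound covers all but finitely many of the measures and the limit.\<close>
  define m where "m = measure M (space M) + 1"
  have m: "0 < m" "measure M (space M) \<le> m"
    by (auto simp: m_def add_nonneg_pos)
  have "\<forall>\<^sub>F n in sequentially. measure (Ms n) (space M) < m"
    using conv[OF sets.top] by (rule order_tendstoD) (simp add: m_def)
  moreover define \<epsilon> where "\<epsilon> = r / (4 * m)"
  have e: "0 < \<epsilon>" "\<epsilon> * m = r / 4"
    using r m by (simp_all add: \<epsilon>_def)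
  obtain I :: "int set" and S a where I: "finite I" and S: "\<And>k. S k \<in> sets M"
    and approx: "\<And>x. x \<in> space M \<Longrightarrow> \<bar>f x - (\<Sum>k\<in>I. a k * indicator (S k) x)\<bar> \<le> \<epsilon>"
    using bounded_uniform_step_approx[OF f B e(1)] by metis
  define g where "g = (\<lambda>x. \<Sum>k\<in>I. a k * indicator (S k) x :: real)"
  have g: "integrable N g \<and> (\<integral>x. g x \<partial>N) = (\<Sum>k\<in>I. a k * measure N (S k))"
    if "finite_measure N" "sets N = sets M" for N
  proof -
    interpret finite_measure N by fact
    have "integrable N (indicator (S k) :: _ \<Rightarrow> real)" for k
      using S that(2) by (simp add: integrable_indicator_iff emeasure_finite less_top[symmetric])
    moreover have "S k \<inter> space N = S k" for k
      using sets.sets_into_space[OF S] sets_eq_imp_space_eq[OF that(2)] by auto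
    ultimately show ?thesis
      unfolding g_def by (subst Bochner_Integration.integral_sum) auto
  qed
  have close: "\<bar>(\<integral>x. f x \<partial>N) - (\<integral>x. g x \<partial>N)\<bar> \<le> r / 4"
    if "finite_measure N" "sets N = sets M" "measure N (space M) \<le> m" for N
  proof -
    have "\<bar>(\<integral>x. f x \<partial>N) - (\<integral>x. g x \<partial>N)\<bar> \<le> \<epsilon> * measure N (space M)"
      using abs_integral_diff_le[of N f g \<epsilon>] f_int[of N] g[of N] approx that
      by (auto simp: sets_eq_imp_space_eq[OF that(2)] g_def)
    also have "\<dots> \<le> \<epsilon> * m"
      using that e by (intro mult_left_mono) auto
    finally show ?thesis by (simp add: e)
  qed
  have "(\<lambda>n. \<integral>x. g x \<partial>Ms n) \<longlonglongrightarrow> (\<integral>x. g x \<partial>M)"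
    using g fin sets conv S by (auto intro!: tendsto_sum tendsto_mult)
  then have "\<forall>\<^sub>F n in sequentially. \<bar>(\<integral>x. g x \<partial>Ms n) - (\<integral>x. g x \<partial>M)\<bar> < r / 4"
    using r tendstoD[of "\<lambda>n. \<integral>x. g x \<partial>Ms n" _ sequentially "r / 4"] by (simp add: dist_real_def)
  ultimately have "\<forall>\<^sub>F n in sequentially. norm ((\<integral>x. f x \<partial>Ms n) - (\<integral>x. f x \<partial>M)) < r"
  proof eventually_elim
    case (elim n)
    have "\<bar>(\<integral>x. f x \<partial>Ms n) - (\<integral>x. g x \<partial>Ms n)\<bar> \<le> r / 4" "\<bar>(\<integral>x. f x \<partial>M) - (\<integral>x. g x \<partial>M)\<bar> \<le> r / 4"
      using close[of "Ms n"] close[of M] fin sets m elim by auto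
    with elim r show ?case
      unfolding real_norm_def by linarith
  qed
  then show "\<exists>N. \<forall>n\<ge>N. norm ((\<integral>x. f x \<partial>Ms n) - (\<integral>x. f x \<partial>M)) < r"
    by (simp add: eventually_sequentially)
qed

lemma joint_in_prob_algebra:
  fixes X :: "'x::second_countable_topology set" and Y :: "'y::second_countable_topology set"
  assumes "prob_space P" "sets P = sets (borel_on X)" "Q \<in> channels X Y"
  shows "joint X Y P Q \<in> space (prob_algebra (borel_on (X \<times> Y)))"
proof -
  have P: "P \<in> space (prob_algebra (borel_on X))"
    using assms by (simp add: space_prob_algebra)
  show ?thesis
    unfolding joint_def
    using prob_space_bind'[OF P joint_kernel[OF assms(3)]] sets_bind'[OF P joint_kernel[OF assms(3)]]
    by (simp add: space_prob_algebra)
qed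

lemma measurable_policy_cost:
  fixes X :: "'x::second_countable_topology set" and Y :: "'y::second_countable_topology set"
    and U :: "'u::second_countable_topology set"
  assumes c: "c \<in> borel_measurable (borel_on (X \<times> U))"
    and \<gamma>: "\<gamma> \<in> borel_on Y \<rightarrow>\<^sub>M borel_on U"
  shows "(\<lambda>(x, y). c (x, \<gamma> y)) \<in> borel_measurable (borel_on (X \<times> Y))"
proof -
  have fst: "fst \<in> borel_on (X \<times> Y) \<rightarrow>\<^sub>M borel"
    unfolding borel_prod[symmetric] by (intro measurable_restrict_space1) simp
  have "snd \<in> borel_on (X \<times> Y) \<rightarrow>\<^sub>M borel_on Y"
    unfolding borel_prod[symmetric]
    by (intro measurable_restrict_space1 measurable_restrict_space2)
      (auto simp: space_restrict_space intro: measurable_restrict_space1)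
  then have "(\<lambda>z. \<gamma> (snd z)) \<in> borel_on (X \<times> Y) \<rightarrow>\<^sub>M borel_on U"
    using \<gamma> by (rule measurable_compose)
  then have \<gamma>': "(\<lambda>z. \<gamma> (snd z)) \<in> borel_on (X \<times> Y) \<rightarrow>\<^sub>M borel"
    and U: "\<And>z. z \<in> X \<times> Y \<Longrightarrow> \<gamma> (snd z) \<in> U"
    by (auto simp: measurable_restrict_space2_iff space_restrict_space)
  have "(\<lambda>z. (fst z, \<gamma> (snd z))) \<in> borel_on (X \<times> Y) \<rightarrow>\<^sub>M borel_on (X \<times> U)"
    using measurable_Pair[OF fst \<gamma>'] U
    by (intro measurable_restrict_space2) (auto simp: borel_prod space_restrict_space)
  from measurable_compose[OF this c] show ?thesis
    by (simp add: split_beta')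
qed

theorem theorem3p3:
  fixes X :: "(real ^ 'n) set" and Y :: "(real ^ 'm) set" and U :: "(real ^ 'k) set"
    and c :: "(real ^ 'n) \<times> (real ^ 'k) \<Rightarrow> real"
    and P :: "(real ^ 'n) measure"
    and Qs :: "nat \<Rightarrow> real ^ 'n \<Rightarrow> (real ^ 'm) measure"
    and Q :: "real ^ 'n \<Rightarrow> (real ^ 'm) measure"
  assumes "X \<in> sets borel" and "Y \<in> sets borel" and "U \<in> sets borel" and "U \<noteq> {}"
    and "prob_space P" and "sets P = sets (borel_on X)"
    and "c \<in> borel_measurable (borel_on (X \<times> U))"
    and "\<And>z. z \<in> X \<times> U \<Longrightarrow> 0 \<le> c z"
    and "bounded (c ` (X \<times> U))"
    and "\<And>n. Qs n \<in> channels X Y" and "Q \<in> channels X Y"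
    and "setwise_at X Y P Qs Q"
  shows "limsup (\<lambda>n. opt_cost X Y U c P (Qs n)) \<le> opt_cost X Y U c P Q"
proof -
  have joint: "prob_space (joint X Y P R)" "sets (joint X Y P R) = sets (borel_on (X \<times> Y))"
    if "R \<in> channels X Y" for R
    using joint_in_prob_algebra[OF assms(5,6) that] by (auto simp: space_prob_algebra)
  obtain B where B: "\<And>z. z \<in> X \<times> U \<Longrightarrow> \<bar>c z\<bar> \<le> B"
    using assms(9) by (auto simp: bounded_iff)
  have "limsup (\<lambda>n. opt_cost X Y U c P (Qs n)) \<le> ereal (\<integral>(x, y). c (x, \<gamma> y) \<partial>joint X Y P Q)"
    if \<gamma>: "\<gamma> \<in> borel_on Y \<rightarrow>\<^sub>M borel_on U" for \<gamma>
  proof -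
    have "(\<lambda>n. \<integral>(x, y). c (x, \<gamma> y) \<partial>joint X Y P (Qs n)) \<longlonglongrightarrow> (\<integral>(x, y). c (x, \<gamma> y) \<partial>joint X Y P Q)"
    proof (rule integral_tendsto_of_setwise)
      show "(\<lambda>(x, y). c (x, \<gamma> y)) \<in> borel_measurable (joint X Y P Q)"
        using measurable_policy_cost[OF assms(7) \<gamma>] joint(2)[OF assms(11)]
        by (simp cong: measurable_cong_sets)
      show "\<bar>case z of (x, y) \<Rightarrow> c (x, \<gamma> y)\<bar> \<le> B" if "z \<in> space (joint X Y P Q)" for z
        using that sets_eq_imp_space_eq[OF joint(2)[OF assms(11)]] measurable_space[OF \<gamma>]
        by (auto simp: space_restrict_space intro!: B)
      show "(\<lambda>n. measure (joint X Y P (Qs n)) A) \<longlonglongrightarrow> measure (joint X Y P Q) A"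
        if "A \<in> sets (joint X Y P Q)" for A
        using that assms(12) joint(2)[OF assms(11)] by (simp add: setwise_at_def)
    qed (use assms(10,11) joint in \<open>auto simp: prob_space_def\<close>)
    then have lim: "(\<lambda>n. ereal (\<integral>(x, y). c (x, \<gamma> y) \<partial>joint X Y P (Qs n)))
        \<longlonglongrightarrow> ereal (\<integral>(x, y). c (x, \<gamma> y) \<partial>joint X Y P Q)"
      by simp
    have "limsup (\<lambda>n. opt_cost X Y U c P (Qs n))
        \<le> limsup (\<lambda>n. ereal (\<integral>(x, y). c (x, \<gamma> y) \<partial>joint X Y P (Qs n)))"
      unfolding opt_cost_def using \<gamma> by (intro Limsup_mono always_eventually allI INF_lower)
    with lim_imp_Limsup[OF _ lim] show ?thesis
      by simp
  qed
  then show ?thesis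
    unfolding opt_cost_def[of X Y U c P Q] by (rule INF_greatest)
qed

end
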